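(* Let $(M,d)$ be a locally compact and complete metric space. Then $\mathrm{Ran}(M)$, equipped with the uniformity having as a basis of entourages the sets $$V^\omega_\epsilon=\{(X,Y)\in\mathrm{Ran}(M)\times\mathrm{Ran}(M)\mid d^\omega(X,Y)<\epsilon\},\qquad \omega \text{ a weight},\ \epsilon>0,$$ is a complete uniform space.
   Context: $\mathrm{Ran}(M)$ is the set of non-empty finite subsets of $M$ (called configurations). A weight is a non-decreasing function $\omega\colon\{1,2,3,\dots\}\to[1,\infty)$ with $\omega(1)=1$. For $X,Y\in\mathrm{Ran}(M)$, a surjective relation from $X$ to $Y$ is a subset $R\subset X\times Y$ such that every $x\in X$ is related to at least one $y\in Y$ and every $y\in Y$ is related to at least one $x\in X$; its $\omega$-length is $\ell^\omega(R)=\omega(\mathrm{card}(R))\sum_{(x,y)\in R}d(x,y)$, where $\mathrm{card}(R)$ is the number of pairs in $R$. A combinatorial chain from $X$ to $Y$ consists of configurations $X=X_0,X_1,\dots,X_k=Y$ ($k\ge 0$) and surjective relations $R_j$ from $X_j$ to $X_{j+1}$, $0\le j\le k-1$; its $\omega$-length is $\sum_{j=0}^{k-1}\ell^\omega(R_j)$. The weighted distance $d^\omega(X,Y)$ is the infimum of the $\omega$-lengths of all combinatorial chains from $X$ to $Y$; it is a metric on $\mathrm{Ran}(M)$. A uniform space is complete if every Cauchy filter converges (for the topology induced by the uniformity). *)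

theory Defs
  imports "HOL-Analysis.Analysis"
begin

typedef 'a ran = "{X :: 'a set. finite X \<and> X \<noteq> {}}"
  morphisms points Ran
  by blast

text \<open>
  Weights are functions on the positive integers; the value at \<open>0\<close> is unconstrained and never
  used, since a surjective relation between configurations is non-empty.
\<close>

definition weight :: "(nat \<Rightarrow> real) \<Rightarrow> bool" where
  "weight \<omega> \<longleftrightarrow> mono_on {1..} \<omega> \<and> \<omega> ` {1..} \<subseteq> {1..} \<and> \<omega> 1 = 1"

definition surjective_relation :: "'a ran \<Rightarrow> 'a ran \<Rightarrow> ('a \<times> 'a) set \<Rightarrow> bool" where
  "surjective_relation X Y R \<longleftrightarrow>
     R \<subseteq> points X \<times> points Y \<and>
     (\<forall>x\<in>points X. \<exists>y\<in>points Y. (x, y) \<in> R) \<and>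
     (\<forall>y\<in>points Y. \<exists>x\<in>points X. (x, y) \<in> R)"

definition relation_length :: "(nat \<Rightarrow> real) \<Rightarrow> ('a::metric_space \<times> 'a) set \<Rightarrow> real" where
  "relation_length \<omega> R = \<omega> (card R) * (\<Sum>(x, y)\<in>R. dist x y)"

text \<open>
  A chain of \<open>k\<close> steps is given by \<open>C 0, \<dots>, C k\<close> and \<open>R 0, \<dots>, R (k - 1)\<close>; the other values of
  the two sequences are irrelevant.
\<close>

definition combinatorial_chain ::
  "'a ran \<Rightarrow> 'a ran \<Rightarrow> nat \<Rightarrow> (nat \<Rightarrow> 'a ran) \<Rightarrow> (nat \<Rightarrow> ('a \<times> 'a) set) \<Rightarrow> bool" where
  "combinatorial_chain X Y k C R \<longleftrightarrow>
     C 0 = X \<and> C k = Y \<and> (\<forall>j<k. surjective_relation (C j) (C (Suc j)) (R j))"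

definition chain_length ::
  "(nat \<Rightarrow> real) \<Rightarrow> nat \<Rightarrow> (nat \<Rightarrow> ('a::metric_space \<times> 'a) set) \<Rightarrow> real" where
  "chain_length \<omega> k R = (\<Sum>j<k. relation_length \<omega> (R j))"

definition weighted_dist :: "(nat \<Rightarrow> real) \<Rightarrow> 'a::metric_space ran \<Rightarrow> 'a ran \<Rightarrow> real" where
  "weighted_dist \<omega> X Y = Inf {chain_length \<omega> k R | k C R. combinatorial_chain X Y k C R}"

definition ran_entourage ::
  "(nat \<Rightarrow> real) \<Rightarrow> real \<Rightarrow> ('a::metric_space ran \<times> 'a ran) set" where
  "ran_entourage \<omega> \<epsilon> = {(X, Y). weighted_dist \<omega> X Y < \<epsilon>}"


subsection \<open>The infimum defining the weighted distance is over a non-empty set bounded below\<close>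

lemma finite_points [simp]: "finite (points X)"
  and points_nonempty [simp]: "points X \<noteq> {}"
  using points[of X] by auto

lemma surjective_relation_finite: "surjective_relation X Y R \<Longrightarrow> finite R"
  unfolding surjective_relation_def by (meson finite_SigmaI finite_points finite_subset)

lemma surjective_relation_card: "surjective_relation X Y R \<Longrightarrow> card R \<ge> 1"
  using surjective_relation_finite[of X Y R] points_nonempty[of X]
  by (fastforce simp: surjective_relation_def Suc_le_eq card_gt_0_iff)

lemma weight_ge_1: "weight \<omega> \<Longrightarrow> n \<ge> 1 \<Longrightarrow> \<omega> n \<ge> 1"
  unfolding weight_def by fastforce

lemma relation_length_nonneg:
  assumes "weight \<omega>" "surjective_relation X Y R"
  shows "relation_length \<omega> R \<ge> 0"
  unfolding relation_length_def
  using weight_ge_1[OF assms(1) surjective_relation_card[OF assms(2)]]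
  by (auto intro!: mult_nonneg_nonneg sum_nonneg)

lemma chain_length_nonneg:
  assumes "weight \<omega>" "combinatorial_chain X Y k C R"
  shows "chain_length \<omega> k R \<ge> 0"
  using assms unfolding chain_length_def combinatorial_chain_def
  by (auto intro!: sum_nonneg intro: relation_length_nonneg)

lemma combinatorial_chain_exists: "\<exists>k C R. combinatorial_chain X Y k C R"
  by (rule exI[of _ 1], rule exI[of _ "\<lambda>j. if j = 0 then X else Y"],
      rule exI[of _ "\<lambda>_. points X \<times> points Y"])
    (auto simp: combinatorial_chain_def surjective_relation_def ex_in_conv)

lemma weighted_dist_le:
  assumes "weight \<omega>" "combinatorial_chain X Y k C R"
  shows "weighted_dist \<omega> X Y \<le> chain_length \<omega> k R"
  unfolding weighted_dist_def
  by (rule cInf_lower) (use assms in \<open>auto intro!: bdd_belowI[of _ 0] chain_length_nonneg\<close>)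

lemma weighted_dist_greatest:
  assumes "\<And>k C R. combinatorial_chain X Y k C R \<Longrightarrow> b \<le> chain_length \<omega> k R"
  shows "b \<le> weighted_dist \<omega> X Y"
  unfolding weighted_dist_def
  by (rule cInf_greatest) (use assms combinatorial_chain_exists[of X Y] in auto)

lemma weighted_dist_lessE:
  assumes "weighted_dist \<omega> X Y < e"
  obtains k C R where "combinatorial_chain X Y k C R" "chain_length \<omega> k R < e"
  using weighted_dist_greatest[of X Y e \<omega>] assms by (meson not_le)


subsection \<open>The uniformity\<close>

lemma weighted_dist_self:
  assumes "weight \<omega>"
  shows "weighted_dist \<omega> X X \<le> 0"
  using weighted_dist_le[OF assms, of X X 0 "\<lambda>_. X"]
  by (simp add: combinatorial_chain_def chain_length_def)

lemma surjective_relation_converse: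
  "surjective_relation X Y R \<Longrightarrow> surjective_relation Y X (R\<inverse>)"
  unfolding surjective_relation_def by blast

lemma relation_length_converse: "relation_length \<omega> (R\<inverse>) = relation_length \<omega> R"
proof -
  have "(\<Sum>(x, y)\<in>R\<inverse>. dist x y) = (\<Sum>(x, y)\<in>R. dist x y)"
    by (rule sum.reindex_bij_witness[of _ prod.swap prod.swap]) (auto simp: dist_commute)
  then show ?thesis
    by (simp add: relation_length_def)
qed

lemma weighted_dist_sym_le:
  assumes "weight \<omega>"
  shows "weighted_dist \<omega> Y X \<le> weighted_dist \<omega> X Y"
proof (rule weighted_dist_greatest)
  fix k C R
  assume c: "combinatorial_chain X Y k C R"
  define C' where "C' = (\<lambda>j. C (k - j))"
  define R' where "R' = (\<lambda>j. (R (k - Suc j))\<inverse>)"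
  have "surjective_relation (C' j) (C' (Suc j)) (R' j)" if "j < k" for j
  proof -
    have "surjective_relation (C (k - Suc j)) (C (Suc (k - Suc j))) (R (k - Suc j))"
      using c that unfolding combinatorial_chain_def by auto
    then show ?thesis
      using that by (auto simp: C'_def R'_def Suc_diff_Suc intro: surjective_relation_converse)
  qed
  then have "combinatorial_chain Y X k C' R'"
    using c by (auto simp: combinatorial_chain_def C'_def)
  moreover have "chain_length \<omega> k R' = chain_length \<omega> k R"
    unfolding chain_length_def R'_def relation_length_converse
    by (rule sum.nat_diff_reindex)
  ultimately show "weighted_dist \<omega> Y X \<le> chain_length \<omega> k R"
    using weighted_dist_le[OF assms] by metis
qed

lemma combinatorial_chain_append:
  assumes "combinatorial_chain X Y k C R" "combinatorial_chain Y Z l D S"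
  shows "combinatorial_chain X Z (k + l) (\<lambda>j. if j \<le> k then C j else D (j - k))
           (\<lambda>j. if j < k then R j else S (j - k))"
proof -
  have "surjective_relation (if j \<le> k then C j else D (j - k))
          (if Suc j \<le> k then C (Suc j) else D (Suc j - k)) (if j < k then R j else S (j - k))"
    if "j < k + l" for j
  proof (cases "j < k")
    case True
    then show ?thesis using assms(1) by (auto simp: combinatorial_chain_def)
  next
    case False
    then have "j - k < l" "(if j \<le> k then C j else D (j - k)) = D (j - k)" "Suc j - k = Suc (j - k)"
      using that assms by (auto simp: combinatorial_chain_def)
    then show ?thesis using False assms(2) by (auto simp: combinatorial_chain_def)
  qed
  then show ?thesis
    using assms by (auto simp: combinatorial_chain_def)
qed

lemma weighted_dist_triangle_less:
  assumes "weight \<omega>" "weighted_dist \<omega> X Y < a" "weighted_dist \<omega> Y Z < b"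
  shows "weighted_dist \<omega> X Z < a + b"
proof -
  obtain k C R where 1: "combinatorial_chain X Y k C R" "chain_length \<omega> k R < a"
    using weighted_dist_lessE[OF assms(2)] .
  obtain l D S where 2: "combinatorial_chain Y Z l D S" "chain_length \<omega> l S < b"
    using weighted_dist_lessE[OF assms(3)] .
  let ?T = "\<lambda>j. if j < k then R j else S (j - k)"
  have "chain_length \<omega> (k + l) ?T = chain_length \<omega> k R + chain_length \<omega> l S"
    unfolding chain_length_def by (induction l) auto
  then show ?thesis
    using weighted_dist_le[OF assms(1) combinatorial_chain_append[OF 1(1) 2(1)]] 1(2) 2(2)
    by linarith
qed

lemma weight_max:
  assumes "weight \<omega>" "weight \<omega>'"
  shows "weight (\<lambda>n. max (\<omega> n) (\<omega>' n))"
proof -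
  have "mono_on {1..} (\<lambda>n. max (\<omega> n) (\<omega>' n))"
    using assms unfolding weight_def by (intro mono_onI max.mono) (auto elim!: mono_onD)
  moreover have "1 \<le> max (\<omega> n) (\<omega>' n)" if "n \<ge> 1" for n
    using weight_ge_1[OF assms(1) that] by linarith
  ultimately show ?thesis
    using assms by (auto simp: weight_def)
qed

lemma weight_one: "weight (\<lambda>_. 1)"
  by (auto simp: weight_def mono_on_def)

lemma weighted_dist_mono:
  assumes "weight \<omega>" "\<And>n. \<omega> n \<le> \<omega>' n"
  shows "weighted_dist \<omega> X Y \<le> weighted_dist \<omega>' X Y"
proof (rule weighted_dist_greatest)
  fix k C R
  assume c: "combinatorial_chain X Y k C R"
  have "chain_length \<omega> k R \<le> chain_length \<omega>' k R"
    unfolding chain_length_def relation_length_def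
    by (intro sum_mono mult_right_mono assms sum_nonneg) auto
  then show "weighted_dist \<omega> X Y \<le> chain_length \<omega>' k R"
    using weighted_dist_le[OF assms(1) c] by linarith
qed

instantiation ran :: (metric_space) uniform_space
begin

definition uniformity_ran :: "('a ran \<times> 'a ran) filter" where
  "uniformity_ran =
     (INF (\<omega>, \<epsilon>) \<in> {\<omega>. weight \<omega>} \<times> {0<..}. principal (ran_entourage \<omega> \<epsilon>))"

definition open_ran :: "'a ran set \<Rightarrow> bool" where
  "open_ran U \<longleftrightarrow> (\<forall>x\<in>U. \<forall>\<^sub>F (x', y) in uniformity. x' = x \<longrightarrow> y \<in> U)"

text \<open>The entourages form a basis of the uniformity, not merely a subbasis.\<close>

lemma eventually_uniformity_ran:
  "eventually P (uniformity :: ('a ran \<times> 'a ran) filter) \<longleftrightarrow>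
     (\<exists>\<omega> \<epsilon>. weight \<omega> \<and> \<epsilon> > 0 \<and> (\<forall>z\<in>ran_entourage \<omega> \<epsilon>. P z))"
  unfolding uniformity_ran_def
proof (subst eventually_INF_base)
  show "{\<omega>. weight \<omega>} \<times> {0::real<..} \<noteq> {}"
    using weight_one by (auto simp: Sigma_empty_iff)
next
  fix a b :: "(nat \<Rightarrow> real) \<times> real"
  assume ab: "a \<in> {\<omega>. weight \<omega>} \<times> {0<..}" "b \<in> {\<omega>. weight \<omega>} \<times> {0<..}"
  obtain v d w e where [simp]: "a = (v, d)" "b = (w, e)"
    by (metis surj_pair)
  define u where "u = (\<lambda>n. max (v n) (w n))"
  have le: "weighted_dist v X Y \<le> weighted_dist u X Y" "weighted_dist w X Y \<le> weighted_dist u X Y"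
    for X Y :: "'a ran"
    using ab by (auto simp: u_def intro!: weighted_dist_mono)
  have "ran_entourage u (min d e) \<subseteq> ran_entourage v d \<inter> (ran_entourage w e :: ('a ran \<times> 'a ran) set)"
    by (auto simp: ran_entourage_def intro: le[THEN le_less_trans])
  moreover have "(u, min d e) \<in> {\<omega>. weight \<omega>} \<times> {0<..}"
    using ab by (auto simp: u_def intro: weight_max)
  ultimately show "\<exists>x\<in>{\<omega>. weight \<omega>} \<times> {0<..}.
      (case x of (\<omega>, \<epsilon>) \<Rightarrow> principal (ran_entourage \<omega> \<epsilon>)) \<le>
      inf (case a of (\<omega>, \<epsilon>) \<Rightarrow> principal (ran_entourage \<omega> \<epsilon>))
        (case b of (\<omega>, \<epsilon>) \<Rightarrow> principal (ran_entourage \<omega> \<epsilon> :: ('a ran \<times> 'a ran) set))"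
    by (intro bexI[of _ "(u, min d e)"]) auto
qed (auto simp: eventually_principal)

instance
proof
  fix U :: "'a ran set"
  show "open U \<longleftrightarrow> (\<forall>x\<in>U. \<forall>\<^sub>F (x', y) in uniformity. x' = x \<longrightarrow> y \<in> U)"
    by (rule open_ran_def)
next
  fix E :: "'a ran \<times> 'a ran \<Rightarrow> bool" and X :: "'a ran"
  assume "eventually E uniformity"
  then show "E (X, X)"
    unfolding eventually_uniformity_ran
    by (auto simp: ran_entourage_def intro: weighted_dist_self[THEN le_less_trans])
next
  fix E :: "'a ran \<times> 'a ran \<Rightarrow> bool"
  assume "eventually E uniformity"
  then obtain \<omega> \<epsilon> where we: "weight \<omega>" "\<epsilon> > 0" "\<forall>z\<in>ran_entourage \<omega> \<epsilon>. E z"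
    unfolding eventually_uniformity_ran by blast
  then have "\<forall>(X, Y)\<in>ran_entourage \<omega> \<epsilon>. E (Y, X)"
    by (auto simp: ran_entourage_def intro: weighted_dist_sym_le[THEN le_less_trans])
  with we show "\<forall>\<^sub>F (X, Y) in uniformity. E (Y, X)"
    unfolding eventually_uniformity_ran by blast
next
  fix E :: "'a ran \<times> 'a ran \<Rightarrow> bool"
  assume "eventually E uniformity"
  then obtain \<omega> \<epsilon> where we: "weight \<omega>" "\<epsilon> > 0" "\<forall>z\<in>ran_entourage \<omega> \<epsilon>. E z"
    unfolding eventually_uniformity_ran by blast
  let ?D = "\<lambda>z :: 'a ran \<times> 'a ran. z \<in> ran_entourage \<omega> (\<epsilon> / 2)"
  have "eventually ?D uniformity"
    unfolding eventually_uniformity_ran using we by (meson half_gt_zero)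
  moreover have "?D (X, Y) \<longrightarrow> ?D (Y, Z) \<longrightarrow> E (X, Z)" for X Y Z
    using weighted_dist_triangle_less[OF we(1), of X Y "\<epsilon> / 2" Z "\<epsilon> / 2"] we(3)
    by (auto simp: ran_entourage_def)
  ultimately show "\<exists>D. eventually D uniformity \<and>
      (\<forall>X Y Z. D (X, Y) \<longrightarrow> D (Y, Z) \<longrightarrow> E (X, Z))"
    by blast
qed

end

end

theory Submission
  imports Defs
begin

text \<open>
  Let \<open>F\<close> be a Cauchy filter of configurations. The only candidate for its limit is the set \<open>K\<close> of
  all points \<open>p\<close> such that the configurations in \<open>F\<close> eventually meet every ball around \<open>p\<close>. Since
  all weighted distances dominate the Hausdorff distance, completeness of \<open>M\<close> yields, as for the
  hyperspace of a complete space, that the configurations eventually lie in any given neighbourhood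
  of \<open>K\<close> (\<open>eventually_close_to_limit_points\<close>). In particular \<open>K\<close> is non-empty. Two things remain.

  First, \<open>K\<close> is finite (\<open>finite_limit_points\<close>). This is where varying the weight is essential: a
  configuration that approximates \<open>n\<close> separated points of \<open>K\<close> closely has at least \<open>n\<close> points,
  hence every relation ending in it has at least \<open>n\<close> pairs and its length is multiplied by at least
  \<open>\<omega> n\<close>. If \<open>K\<close> were infinite, a weight growing fast enough, compared with the separation of
  the \<open>n\<close>-point subsets of \<open>K\<close>, would make the last stretch of any chain from a configuration with
  fewer than \<open>n\<close> points to one close to \<open>K\<close> cost at least 1 (\<open>weighted_dist_ge_resolution\<close>),
  for every \<open>n \<ge> 2\<close>. But every configuration has fewer than \<open>n\<close> points for some \<open>n\<close>, so no set of
  the filter could be small of order 1.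

  Second, \<open>F\<close> converges to \<open>K\<close> for every weight \<open>\<omega>\<close> (\<open>cauchy_filter_ran_converges\<close>). Moving the
  points of a configuration directly to \<open>K\<close> can be expensive, because their number need not be
  bounded along \<open>F\<close>. Fix instead a configuration \<open>X\<close> in a small set of the filter and choose a second one
  \<open>Z\<close> in it, so close to \<open>K\<close> that even \<open>card X\<close> points can be moved cheaply from \<open>Z\<close> to \<open>K\<close>. A
  short chain from \<open>X\<close> to \<open>Z\<close> may end in many more points than \<open>X\<close> has, but one can follow just one
  path from each point of \<open>X\<close> (\<open>follow_chain\<close>). This gives a chain that is no longer and ends in a
  subset of \<open>Z\<close> with at most \<open>card X\<close> points, which is then cheaply moved onto \<open>K\<close>.
\<close>

section \<open>Following the points of a configuration along a chain\<close>

lemma points_Ran: "finite A \<Longrightarrow> A \<noteq> {} \<Longrightarrow> points (Ran A) = A"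
  by (simp add: Ran_inverse)

lemma card_points_ge_1: "card (points X) \<ge> 1"
  by (simp add: Suc_le_eq card_gt_0_iff)

lemma weight_mono: "weight \<omega> \<Longrightarrow> 1 \<le> m \<Longrightarrow> m \<le> n \<Longrightarrow> \<omega> m \<le> \<omega> n"
  by (auto simp: weight_def elim!: mono_onD)

lemma weighted_dist_triangle:
  assumes "weight \<omega>"
  shows "weighted_dist \<omega> X Z \<le> weighted_dist \<omega> X Y + weighted_dist \<omega> Y Z"
proof (rule field_le_epsilon)
  fix e :: real
  assume "e > 0"
  then show "weighted_dist \<omega> X Z \<le> weighted_dist \<omega> X Y + weighted_dist \<omega> Y Z + e"
    using weighted_dist_triangle_less[OF assms, of X Y "weighted_dist \<omega> X Y + e / 2" Z
        "weighted_dist \<omega> Y Z + e / 2"]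
    by simp
qed

text \<open>Moving each point along a function uses the graph as relation, with one pair per point.\<close>

lemma weighted_dist_image_le:
  assumes "weight \<omega>"
  shows "weighted_dist \<omega> X (Ran (f ` points X)) \<le>
    \<omega> (card (points X)) * (\<Sum>x\<in>points X. dist x (f x))"
proof -
  let ?G = "(\<lambda>x. (x, f x)) ` points X"
  have inj: "inj_on (\<lambda>x. (x, f x)) (points X)"
    by (auto intro: inj_onI)
  have "combinatorial_chain X (Ran (f ` points X)) 1
      (\<lambda>j. if j = 0 then X else Ran (f ` points X)) (\<lambda>_. ?G)"
    by (auto simp: combinatorial_chain_def surjective_relation_def points_Ran)
  from weighted_dist_le[OF assms this] show ?thesis
    by (simp add: chain_length_def relation_length_def card_image[OF inj] sum.reindex[OF inj])
qed

lemma combinatorial_chain_Suc: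
  assumes "combinatorial_chain X Y (Suc k) C R"
  shows "surjective_relation X (C 1) (R 0)"
    and "combinatorial_chain (C 1) Y k (\<lambda>j. C (Suc j)) (\<lambda>j. R (Suc j))"
  using assms by (auto simp: combinatorial_chain_def)

lemma chain_length_Suc:
  "chain_length \<omega> (Suc k) R = relation_length \<omega> (R 0) + chain_length \<omega> k (\<lambda>j. R (Suc j))"
  unfolding chain_length_def by (rule sum.lessThan_Suc_shift)

text \<open>
  Choosing for every point one successor at each step thins a chain out to a chain of graphs of
  functions. Each relation only loses pairs, so neither its sum of distances nor its weight factor
  grows, and the number of points never increases. The chain may start from a subset \<open>Z\<close> of \<open>X\<close>,
  as the images of the first step need not fill the second configuration.
\<close>

lemma follow_chain:
  assumes "weight \<omega>" "combinatorial_chain X Y k C R" "points Z \<subseteq> points X"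
  shows "\<exists>f. f ` points Z \<subseteq> points Y \<and> (\<forall>x\<in>points Z. dist x (f x) \<le> chain_length \<omega> k R) \<and>
    weighted_dist \<omega> Z (Ran (f ` points Z)) \<le> chain_length \<omega> k R"
  using assms(2,3)
proof (induction k arbitrary: X C R Z)
  case 0
  then show ?case
    using weighted_dist_self[OF assms(1), of Z]
    by (intro exI[of _ id]) (auto simp: combinatorial_chain_def chain_length_def points_inverse)
next
  case (Suc k)
  note surj = combinatorial_chain_Suc(1)[OF Suc.prems(1)]
  define L where "L = chain_length \<omega> k (\<lambda>j. R (Suc j))"
  have "\<forall>x\<in>points Z. \<exists>y. (x, y) \<in> R 0"
    using surj Suc.prems(2) unfolding surjective_relation_def by blast
  then obtain g where g: "\<And>x. x \<in> points Z \<Longrightarrow> (x, g x) \<in> R 0"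
    by metis
  define Z' where "Z' = Ran (g ` points Z)"
  have Z': "points Z' = g ` points Z"
    by (simp add: Z'_def points_Ran)
  have "points Z' \<subseteq> points (C 1)"
    using g surj unfolding Z' surjective_relation_def by blast
  then obtain f where f: "f ` points Z' \<subseteq> points Y"
      "\<forall>x\<in>points Z'. dist x (f x) \<le> L" "weighted_dist \<omega> Z' (Ran (f ` points Z')) \<le> L"
    using Suc.IH[OF combinatorial_chain_Suc(2)[OF Suc.prems(1)]] unfolding L_def by blast
  have finR: "finite (R 0)"
    using surjective_relation_finite[OF surj] .
  have inj: "inj_on (\<lambda>x. (x, g x)) (points Z)"
    by (auto intro: inj_onI)
  have sub: "(\<lambda>x. (x, g x)) ` points Z \<subseteq> R 0"
    using g by auto
  have card: "card (points Z) \<le> card (R 0)"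
    using card_mono[OF finR sub] card_image[OF inj] by simp
  have sum: "(\<Sum>x\<in>points Z. dist x (g x)) \<le> (\<Sum>(x, y)\<in>R 0. dist x y)"
  proof -
    have "(\<Sum>x\<in>points Z. dist x (g x)) = (\<Sum>(x, y)\<in>(\<lambda>x. (x, g x)) ` points Z. dist x y)"
      by (simp add: sum.reindex[OF inj])
    also have "\<dots> \<le> (\<Sum>(x, y)\<in>R 0. dist x y)"
      by (intro sum_mono2[OF finR sub]) auto
    finally show ?thesis .
  qed
  have "\<omega> (card (points Z)) * (\<Sum>x\<in>points Z. dist x (g x)) \<le> relation_length \<omega> (R 0)"
    unfolding relation_length_def
    using weight_mono[OF assms(1) card_points_ge_1 card] sum
      weight_ge_1[OF assms(1) card_points_ge_1, of Z]
      weight_ge_1[OF assms(1) surjective_relation_card[OF surj]]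
    by (intro mult_mono) (auto intro: sum_nonneg)
  moreover have "1 * (\<Sum>x\<in>points Z. dist x (g x)) \<le>
      \<omega> (card (points Z)) * (\<Sum>x\<in>points Z. dist x (g x))"
    by (intro mult_right_mono weight_ge_1[OF assms(1) card_points_ge_1] sum_nonneg) auto
  ultimately have step: "(\<Sum>x\<in>points Z. dist x (g x)) \<le> relation_length \<omega> (R 0)"
      "weighted_dist \<omega> Z Z' \<le> relation_length \<omega> (R 0)"
    using weighted_dist_image_le[OF assms(1), of Z g] unfolding Z'_def by linarith+
  have "dist x (f (g x)) \<le> chain_length \<omega> (Suc k) R" if "x \<in> points Z" for x
  proof -
    have "dist x (g x) \<le> (\<Sum>x\<in>points Z. dist x (g x))"
      using that by (intro member_le_sum) auto
    moreover have "dist (g x) (f (g x)) \<le> L"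
      using f(2) that Z' by auto
    ultimately show ?thesis
      using step(1) dist_triangle[of x "f (g x)" "g x"] unfolding chain_length_Suc L_def by linarith
  qed
  moreover have "weighted_dist \<omega> Z (Ran ((f \<circ> g) ` points Z)) \<le> chain_length \<omega> (Suc k) R"
    using weighted_dist_triangle[OF assms(1), of Z "Ran (f ` points Z')" Z'] step(2) f(3)
    unfolding chain_length_Suc L_def Z' image_comp by linarith
  ultimately show ?case
    using f(1) Z' by (intro exI[of _ "f \<circ> g"]) auto
qed

text \<open>
  Besides the control on the cost of moving \<open>X\<close> into \<open>Y\<close>, this contains the comparison with the
  Hausdorff distance: every point of \<open>X\<close> has a point of \<open>Y\<close> nearby.
\<close>

lemma weighted_dist_less_map:
  assumes "weight \<omega>" "weighted_dist \<omega> X Y < e"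
  obtains f where "f ` points X \<subseteq> points Y" "\<And>x. x \<in> points X \<Longrightarrow> dist x (f x) < e"
    "weighted_dist \<omega> X (Ran (f ` points X)) < e"
proof -
  obtain k C R where "combinatorial_chain X Y k C R" and len: "chain_length \<omega> k R < e"
    using weighted_dist_lessE[OF assms(2)] .
  from follow_chain[OF assms(1) this(1) subset_refl] obtain f where
    "f ` points X \<subseteq> points Y" "\<forall>x\<in>points X. dist x (f x) \<le> chain_length \<omega> k R"
    "weighted_dist \<omega> X (Ran (f ` points X)) \<le> chain_length \<omega> k R"
    by blast
  with len show ?thesis
    by (intro that[of f]) (auto intro: le_less_trans)
qed


section \<open>The price of resolving many points\<close>

lemma finite_separated:
  fixes S :: "'a::metric_space set"
  assumes "finite S"
  shows "\<exists>s>0. \<forall>x\<in>S. \<forall>y\<in>S. x \<noteq> y \<longrightarrow> s \<le> dist x y"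
proof -
  have fin: "finite (insert 1 ((\<lambda>(x, y). dist x y) ` (S \<times> S - Id)))" (is "finite ?D")
    using assms by auto
  have "Min ?D > 0"
    using fin by (subst Min_gr_iff) auto
  moreover have "Min ?D \<le> dist x y" if "x \<in> S" "y \<in> S" "x \<noteq> y" for x y
    using fin that by (intro Min_le) (auto intro!: image_eqI[of _ _ "(x, y)"])
  ultimately show ?thesis
    by blast
qed

text \<open>The balls of radius \<open>h\<close> around points at mutual distance at least \<open>2 * h\<close> are disjoint.\<close>

lemma card_le_of_separated:
  assumes sep: "\<And>p q. p \<in> S \<Longrightarrow> q \<in> S \<Longrightarrow> p \<noteq> q \<Longrightarrow> 2 * h \<le> dist p q"
    and near: "\<forall>p\<in>S. \<exists>x\<in>points X. dist p x < h"
  shows "card S \<le> card (points X)"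
proof -
  obtain g where g: "\<And>p. p \<in> S \<Longrightarrow> g p \<in> points X \<and> dist p (g p) < h"
    using near by metis
  have "inj_on g S"
  proof (rule inj_onI, rule ccontr)
    fix p q
    assume "p \<in> S" "q \<in> S" "g p = g q" "p \<noteq> q"
    then show False
      using sep[of p q] g[of p] g[of q] dist_triangle2[of p q "g p"] by simp
  qed
  then show ?thesis
    using g by (intro card_inj_on_le[of g]) auto
qed

text \<open>
  Running backwards along a chain that ends within \<open>r\<close> of every point of \<open>S\<close>: as long as the
  distance to \<open>S\<close> stays below \<open>h\<close>, the configurations have at least \<open>card S\<close> points, so a step of
  length \<open>l\<close> carries the factor \<open>\<omega> (card S)\<close> and increases this distance by at most
  \<open>l / \<omega> (card S)\<close>. A short chain therefore never leaves the region where this estimate is valid.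
\<close>

lemma chain_preserves_resolution:
  assumes w: "weight \<omega>"
    and S: "S \<noteq> {}" "finite S" "\<And>p q. p \<in> S \<Longrightarrow> q \<in> S \<Longrightarrow> p \<noteq> q \<Longrightarrow> 2 * h \<le> dist p q"
    and chain: "combinatorial_chain X Y k C R"
    and near: "\<forall>p\<in>S. \<exists>y\<in>points Y. dist p y < r"
    and short: "r + chain_length \<omega> k R / \<omega> (card S) \<le> h"
  shows "\<forall>p\<in>S. \<exists>x\<in>points X. dist p x < r + chain_length \<omega> k R / \<omega> (card S)"
  using chain short
proof (induction k arbitrary: X C R)
  case 0
  then show ?case
    using near by (auto simp: combinatorial_chain_def chain_length_def)
next
  case (Suc k)
  note surj = combinatorial_chain_Suc(1)[OF Suc.prems(1)]
  note tail = combinatorial_chain_Suc(2)[OF Suc.prems(1)]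
  have cS: "1 \<le> card S"
    using S by (simp add: Suc_le_eq card_gt_0_iff)
  then have wS: "\<omega> (card S) > 0"
    using weight_ge_1[OF w] by fastforce
  define L where "L = chain_length \<omega> k (\<lambda>j. R (Suc j)) / \<omega> (card S)"
  define M where "M = relation_length \<omega> (R 0) / \<omega> (card S)"
  have LM: "chain_length \<omega> (Suc k) R / \<omega> (card S) = L + M"
    unfolding L_def M_def chain_length_Suc by (simp add: add_divide_distrib)
  have "M \<ge> 0"
    using relation_length_nonneg[OF w surj] wS by (simp add: M_def)
  then have "r + L \<le> h"
    using Suc.prems(2) LM by linarith
  then have near1: "\<forall>p\<in>S. \<exists>x\<in>points (C 1). dist p x < r + L"
    using Suc.IH[OF tail] unfolding L_def by blast
  then have "card S \<le> card (points (C 1))"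
    using \<open>r + L \<le> h\<close> by (intro card_le_of_separated[OF S(3)]) (auto, meson less_le_trans)
  also have "points (C 1) \<subseteq> snd ` R 0"
    using surj unfolding surjective_relation_def by force
  then have "card (points (C 1)) \<le> card (R 0)"
    using surj_card_le[OF surjective_relation_finite[OF surj]] by blast
  finally have "\<omega> (card S) \<le> \<omega> (card (R 0))"
    by (intro weight_mono[OF w cS])
  then have "\<omega> (card S) * (\<Sum>(x, y)\<in>R 0. dist x y) \<le> relation_length \<omega> (R 0)"
    unfolding relation_length_def by (intro mult_right_mono sum_nonneg) auto
  then have sum: "(\<Sum>(x, y)\<in>R 0. dist x y) \<le> M"
    using wS by (simp add: M_def pos_le_divide_eq mult.commute)
  show ?case
  proof
    fix p
    assume "p \<in> S"
    then obtain y where y: "y \<in> points (C 1)" "dist p y < r + L"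
      using near1 by blast
    then obtain x where x: "x \<in> points X" "(x, y) \<in> R 0"
      using surj unfolding surjective_relation_def by blast
    have "dist x y \<le> (\<Sum>(x, y)\<in>R 0. dist x y)"
      using member_le_sum[OF x(2), of "\<lambda>(x, y). dist x y"] surjective_relation_finite[OF surj]
      by auto
    then have "dist p x < r + (L + M)"
      using y sum dist_triangle2[of p x y] by linarith
    then show "\<exists>x\<in>points X. dist p x < r + chain_length \<omega> (Suc k) R / \<omega> (card S)"
      using x(1) LM by auto
  qed
qed

text \<open>
  A configuration with fewer than \<open>card S\<close> points misses some point of \<open>S\<close> by at least \<open>h\<close>. To get
  within \<open>h / 2\<close> of it, a chain has to cover a distance \<open>h / 2\<close> at the rate \<open>\<omega> (card S)\<close>.
\<close>

lemma weighted_dist_ge_resolution: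
  assumes w: "weight \<omega>"
    and S: "finite S" "\<And>p q. p \<in> S \<Longrightarrow> q \<in> S \<Longrightarrow> p \<noteq> q \<Longrightarrow> 2 * h \<le> dist p q"
    and X: "card (points X) < card S"
    and near: "\<forall>p\<in>S. \<exists>y\<in>points Y. dist p y < h / 2"
  shows "\<omega> (card S) * (h / 2) \<le> weighted_dist \<omega> X Y"
proof (rule ccontr)
  assume "\<not> ?thesis"
  then obtain k C R where chain: "combinatorial_chain X Y k C R"
      and len: "chain_length \<omega> k R < \<omega> (card S) * (h / 2)"
    using weighted_dist_lessE[of \<omega> X Y "\<omega> (card S) * (h / 2)"] by auto
  have "S \<noteq> {}" "\<omega> (card S) > 0"
    using X weight_ge_1[OF w, of "card S"] by auto
  then have short: "h / 2 + chain_length \<omega> k R / \<omega> (card S) \<le> h"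
    using len by (simp add: field_simps)
  have "\<forall>p\<in>S. \<exists>x\<in>points X. dist p x < h / 2 + chain_length \<omega> k R / \<omega> (card S)"
    using \<open>S \<noteq> {}\<close> S(1) by (rule chain_preserves_resolution[OF w _ _ S(2) chain near short])
  then have "\<forall>p\<in>S. \<exists>x\<in>points X. dist p x < h"
    using short by (meson less_le_trans)
  then have "card S \<le> card (points X)"
    by (intro card_le_of_separated[OF S(2)])
  with X show False
    by simp
qed


section \<open>The limit points of a Cauchy filter\<close>

definition limit_points :: "'a::metric_space ran filter \<Rightarrow> 'a set" where
  "limit_points F = {p. \<forall>r>0. \<forall>\<^sub>F X in F. \<exists>x\<in>points X. dist p x < r}"

lemma eventually_near_limit_points:
  assumes "finite S" "S \<subseteq> limit_points F" "r > 0"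
  shows "\<forall>\<^sub>F X in F. \<forall>p\<in>S. \<exists>x\<in>points X. dist p x < r"
  using assms by (auto simp: limit_points_def intro!: eventually_ball_finite)

lemma cauchy_filter_ran:
  assumes "cauchy_filter (F :: 'a::metric_space ran filter)" "weight \<omega>" "\<epsilon> > 0"
  obtains A where "\<forall>\<^sub>F X in F. X \<in> A"
    "\<And>X Y. X \<in> A \<Longrightarrow> Y \<in> A \<Longrightarrow> weighted_dist \<omega> X Y < \<epsilon>"
proof -
  have "\<forall>\<^sub>F z in uniformity. z \<in> ran_entourage \<omega> \<epsilon>"
    unfolding eventually_uniformity_ran using assms by blast
  with assms(1) have "\<exists>A. (\<forall>\<^sub>F X in F. X \<in> A) \<and> (\<forall>z\<in>A \<times> A. z \<in> ran_entourage \<omega> \<epsilon>)"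
    unfolding cauchy_filter_iff by fast
  then obtain A where "\<forall>\<^sub>F X in F. X \<in> A" "\<forall>z\<in>A \<times> A. z \<in> ran_entourage \<omega> \<epsilon>"
    by blast
  then show ?thesis
    by (intro that[of A]) (auto simp: ran_entourage_def)
qed

text \<open>
  The contradiction comes from a single weight, chosen before any configuration: it has to make
  \<open>n\<close> points expensive at the scale \<open>h n\<close> for all \<open>n \<ge> 2\<close> at once, since the number of points of
  the configuration \<open>X\<close> to which it is applied is known only afterwards.
\<close>

lemma finite_limit_points:
  fixes F :: "'a::metric_space ran filter"
  assumes "F \<noteq> bot" "cauchy_filter F"
  shows "finite (limit_points F)"
proof (rule ccontr)
  assume "infinite (limit_points F)"
  then obtain p :: "nat \<Rightarrow> 'a" where p: "inj p" "range p \<subseteq> limit_points F"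
    using infinite_countable_subset by blast
  define S where "S n = p ` {..<n}" for n
  have S: "finite (S n)" "card (S n) = n" "S n \<subseteq> limit_points F" for n
    using p(2) card_image[OF inj_on_subset[OF p(1) subset_UNIV], of "{..<n}"]
    unfolding S_def by (simp, simp, blast)
  have "\<exists>h>0. \<forall>x\<in>S n. \<forall>y\<in>S n. x \<noteq> y \<longrightarrow> 2 * h \<le> dist x y" for n
  proof -
    obtain s where "s > 0" "\<forall>x\<in>S n. \<forall>y\<in>S n. x \<noteq> y \<longrightarrow> s \<le> dist x y"
      using finite_separated[OF S(1)[of n]] by blast
    then show ?thesis
      by (intro exI[of _ "s / 2"]) simp
  qed
  then obtain h where h: "\<And>n. h n > 0"
      "\<And>n x y. x \<in> S n \<Longrightarrow> y \<in> S n \<Longrightarrow> x \<noteq> y \<Longrightarrow> 2 * h n \<le> dist x y"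
    by metis
  \<comment> \<open>The partial sums make the weight monotone although \<open>h\<close> need not be decreasing; starting
    them at 2 gives the value 1 at 1.\<close>
  define \<omega> where "\<omega> n = 1 + (\<Sum>i\<in>{2..n}. 2 / h i)" for n :: nat
  have nonneg: "0 \<le> 2 / h i" for i
    using h(1)[of i] by simp
  have "mono_on {1..} \<omega>"
    unfolding \<omega>_def by (intro mono_onI add_left_mono sum_mono2) (use nonneg in auto)
  then have w: "weight \<omega>"
    unfolding weight_def by (auto simp: \<omega>_def intro!: sum_nonneg nonneg)
  have \<omega>_ge: "2 / h n \<le> \<omega> n" if "n \<ge> 2" for n
    using member_le_sum[of n "{2..n}" "\<lambda>i. 2 / h i"] that nonneg by (simp add: \<omega>_def)
  obtain A where A: "\<forall>\<^sub>F X in F. X \<in> A"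
      "\<And>X Y. X \<in> A \<Longrightarrow> Y \<in> A \<Longrightarrow> weighted_dist \<omega> X Y < 1"
    using cauchy_filter_ran[OF assms(2) w, of 1] by auto
  obtain X where X: "X \<in> A"
    using A(1) assms(1) eventually_happens' by blast
  define n where "n = Suc (card (points X))"
  have n: "n \<ge> 2"
    using card_points_ge_1[of X] by (simp add: n_def)
  have "\<forall>\<^sub>F Y in F. Y \<in> A \<and> (\<forall>p\<in>S n. \<exists>y\<in>points Y. dist p y < h n / 2)"
    using A(1) eventually_near_limit_points[OF S(1,3), of "h n / 2" n] h(1)
    by (simp add: eventually_conj)
  then obtain Y where Y: "Y \<in> A" "\<forall>p\<in>S n. \<exists>y\<in>points Y. dist p y < h n / 2"
    using assms(1) eventually_happens' by blast
  have "1 \<le> \<omega> n * (h n / 2)"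
    using \<omega>_ge[OF n] h(1)[of n] by (simp add: field_simps)
  also have "\<dots> \<le> weighted_dist \<omega> X Y"
    using weighted_dist_ge_resolution[OF w S(1)[of n] h(2) _ Y(2)] by (simp add: S(2) n_def)
  finally show False
    using A(2)[OF X Y(1)] by simp
qed

text \<open>
  Since the filter is Cauchy, a point of an early configuration has a nearby point in a later one,
  which in turn has a much closer one in an even later configuration. Iterating this with
  geometrically decreasing distances gives a Cauchy sequence, whose limit is a limit
  point of the filter. The weight constantly 1 is enough for this.
\<close>

lemma eventually_close_to_limit_points:
  fixes F :: "'a::metric_space ran filter"
  assumes M: "complete (UNIV :: 'a set)" and F: "F \<noteq> bot" "cauchy_filter F" and "e > 0"
  shows "\<forall>\<^sub>F X in F. \<forall>x\<in>points X. \<exists>p\<in>limit_points F. dist x p < e"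
proof -
  define \<delta> where "\<delta> i = e / 4 * (1 / 2) ^ i" for i :: nat
  have \<delta>: "\<delta> i > 0" for i
    using \<open>e > 0\<close> by (simp add: \<delta>_def)
  have "\<exists>A. (\<forall>\<^sub>F X in F. X \<in> A) \<and> (\<forall>X\<in>A. \<forall>Y\<in>A. weighted_dist (\<lambda>_. 1) X Y < \<delta> i)" for i
    using cauchy_filter_ran[OF F(2) weight_one \<delta>] by metis
  then obtain A where A: "\<And>i. \<forall>\<^sub>F X in F. X \<in> A i"
      "\<And>i X Y. X \<in> A i \<Longrightarrow> Y \<in> A i \<Longrightarrow> weighted_dist (\<lambda>_. 1) X Y < \<delta> i"
    by metis
  have near: "\<exists>y\<in>points Y. dist x y < \<delta> i"
    if "X \<in> A i" "Y \<in> A i" "x \<in> points X" for X Y x i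
    using weighted_dist_less_map[OF weight_one A(2)[OF that(1,2)]] that(3)
    by (metis image_subset_iff)
  have "\<exists>p\<in>limit_points F. dist x p < e" if X: "X \<in> A 0" and x: "x \<in> points X" for X x
  proof -
    \<comment> \<open>\<open>P\<close> pins the starting point, so that dependent choice yields a sequence beginning at \<open>x\<close>.\<close>
    define P where "P i y \<longleftrightarrow> (\<exists>Y\<in>A i. y \<in> points Y) \<and> (i = 0 \<longrightarrow> y = x)" for i y
    have "\<exists>z. P (Suc i) z \<and> dist y z < \<delta> i" if "P i y" for i y
    proof -
      obtain Y where Y: "Y \<in> A i" "y \<in> points Y"
        using \<open>P i y\<close> unfolding P_def by blast
      \<comment> \<open>The sets \<open>A i\<close> need not be nested, so the next configuration must lie in two of them:
        in \<open>A i\<close> to be close to \<open>Y\<close>, and in \<open>A (Suc i)\<close> to continue.\<close>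
      obtain Z where Z: "Z \<in> A i" "Z \<in> A (Suc i)"
        using eventually_conj[OF A(1)[of i] A(1)[of "Suc i"]] F(1) eventually_happens' by blast
      then obtain z where "z \<in> points Z" "dist y z < \<delta> i"
        using near[OF Y(1) Z(1) Y(2)] by blast
      with Z show ?thesis
        by (auto simp: P_def)
    qed
    moreover have "P 0 x"
      using X x by (auto simp: P_def)
    ultimately obtain y where y: "\<And>i. P i (y i)" "\<And>i. dist (y i) (y (Suc i)) < \<delta> i"
      using dependent_nat_choice[of P "\<lambda>i y z. dist y z < \<delta> i"] by metis
    \<comment> \<open>The subtracted term telescopes, because \<open>\<delta> i = 2 * \<delta> i - 2 * \<delta> (Suc i)\<close>.\<close>
    have tail: "dist (y i) (y (i + m)) \<le> 2 * \<delta> i - 2 * \<delta> (i + m)" for i m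
    proof (induction m)
      case (Suc m)
      then show ?case
        using y(2)[of "i + m"] dist_triangle[of "y i" "y (Suc (i + m))" "y (i + m)"]
        by (simp add: \<delta>_def)
    qed simp
    have bound: "dist (y i) (y j) \<le> 2 * \<delta> i" if "i \<le> j" for i j
      using tail[of i "j - i"] \<delta>[of j] that by simp
    have lim0: "\<delta> \<longlonglongrightarrow> 0"
      unfolding \<delta>_def by (intro tendsto_mult_right_zero LIMSEQ_power_zero) simp
    have "Cauchy y"
    proof (rule metric_CauchyI)
      fix r :: real
      assume "r > 0"
      then have "\<forall>\<^sub>F i in sequentially. \<delta> i < r / 4"
        using lim0 by (intro order_tendstoD) auto
      then obtain N where N: "\<delta> N < r / 4"
        by (auto simp: eventually_sequentially)
      have "dist (y m) (y n) < r" if "m \<ge> N" "n \<ge> N" for m n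
        using bound[OF that(1)] bound[OF that(2)] dist_triangle3[of "y m" "y n" "y N"] N by linarith
      then show "\<exists>N. \<forall>m\<ge>N. \<forall>n\<ge>N. dist (y m) (y n) < r"
        by blast
    qed
    then obtain p where p: "y \<longlonglongrightarrow> p"
      using M unfolding complete_def by blast
    have yp: "dist (y i) p \<le> 2 * \<delta> i" for i
      using bound by (intro Lim_dist_ubound[OF _ p]) (auto intro: eventually_sequentiallyI)
    have "p \<in> limit_points F"
      unfolding limit_points_def
    proof (intro CollectI allI impI)
      fix r :: real
      assume "r > 0"
      then have "\<forall>\<^sub>F i in sequentially. \<delta> i < r / 3"
        using lim0 by (intro order_tendstoD) auto
      then obtain i where i: "\<delta> i < r / 3"
        by (auto simp: eventually_sequentially)
      obtain Y where Y: "Y \<in> A i" "y i \<in> points Y"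
        using y(1) unfolding P_def by blast
      show "\<forall>\<^sub>F Z in F. \<exists>z\<in>points Z. dist p z < r"
        using A(1)[of i]
      proof eventually_elim
        case (elim Z)
        obtain z where "z \<in> points Z" "dist (y i) z < \<delta> i"
          using near[OF Y(1) elim Y(2)] by blast
        then show ?case
          using yp[of i] i dist_triangle3[of p z "y i"] by (intro bexI[of _ z]) linarith+
      qed
    qed
    moreover have "dist x p < e"
      using yp[of 0] y(1)[of 0] \<open>e > 0\<close> by (simp add: P_def \<delta>_def)
    ultimately show ?thesis
      by blast
  qed
  then show ?thesis
    using A(1)[of 0] by (auto elim: eventually_mono)
qed


section \<open>Convergence to the configuration of limit points\<close>

lemma cauchy_filter_ran_converges:
  fixes F :: "'a::metric_space ran filter"
  assumes M: "complete (UNIV :: 'a set)" and F: "F \<noteq> bot" "cauchy_filter F"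
  shows "F \<le> nhds (Ran (limit_points F))"
proof -
  define K where "K = Ran (limit_points F)"
  have fin: "finite (limit_points F)"
    using finite_limit_points[OF F] .
  obtain X where "\<forall>x\<in>points X. \<exists>p\<in>limit_points F. dist x p < 1"
    using eventually_happens'[OF F(1) eventually_close_to_limit_points[OF M F, of 1]] by auto
  then have "limit_points F \<noteq> {}"
    using points_nonempty[of X] by blast
  with fin have K: "points K = limit_points F"
    by (simp add: K_def points_Ran)
  have conv: "\<forall>\<^sub>F X in F. weighted_dist \<omega> K X < \<epsilon>" if w: "weight \<omega>" and "\<epsilon> > 0" for \<omega> \<epsilon>
  proof -
    obtain s where s: "s > 0" "\<And>p q. p \<in> points K \<Longrightarrow> q \<in> points K \<Longrightarrow> p \<noteq> q \<Longrightarrow> s \<le> dist p q"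
      using finite_separated[OF finite_points[of K]] by blast
    \<comment> \<open>Three displacements of size less than \<open>s / 3\<close> cannot lead from one point of \<open>K\<close> to
      another; this will ensure that the points end up covering all of \<open>K\<close>.\<close>
    define \<eta> where "\<eta> = min (\<epsilon> / 2) (s / 3)"
    have \<eta>: "\<eta> > 0" "\<eta> \<le> \<epsilon> / 2" "\<eta> \<le> s / 3"
      using \<open>\<epsilon> > 0\<close> s(1) by (auto simp: \<eta>_def)
    obtain A where A: "\<forall>\<^sub>F X in F. X \<in> A"
        "\<And>X Y. X \<in> A \<Longrightarrow> Y \<in> A \<Longrightarrow> weighted_dist \<omega> X Y < \<eta>"
      using cauchy_filter_ran[OF F(2) w \<eta>(1)] by blast
    have "\<forall>\<^sub>F X in F. \<forall>p\<in>points K. \<exists>x\<in>points X. dist p x < \<eta>"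
      using eventually_near_limit_points[of "points K" F \<eta>] K fin \<eta>(1) by simp
    with A(1) show ?thesis
    proof eventually_elim
      case (elim X)
      \<comment> \<open>Moving at most \<open>card X\<close> points by at most \<open>\<tau>\<close> each costs at most \<open>c * \<tau>\<close>.\<close>
      define c where "c = \<omega> (card (points X)) * real (card (points X))"
      have "c > 0"
        using weight_ge_1[OF w card_points_ge_1[of X]] card_points_ge_1[of X] unfolding c_def
        by (intro mult_pos_pos) linarith+
      define \<tau> where "\<tau> = min (\<epsilon> / (2 * c)) \<eta>"
      have \<tau>: "\<tau> > 0" "\<tau> \<le> \<eta>" "c * \<tau> \<le> \<epsilon> / 2"
        using \<open>c > 0\<close> \<open>\<epsilon> > 0\<close> \<eta>(1) by (auto simp: \<tau>_def min_def field_simps)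
      have "\<forall>\<^sub>F Z in F. Z \<in> A \<and> (\<forall>z\<in>points Z. \<exists>p\<in>points K. dist z p < \<tau>)"
        using A(1) eventually_close_to_limit_points[OF M F \<tau>(1)] K by (simp add: eventually_conj)
      then obtain Z where Z: "Z \<in> A" "\<forall>z\<in>points Z. \<exists>p\<in>points K. dist z p < \<tau>"
        using F(1) eventually_happens' by blast
      obtain f where f: "f ` points X \<subseteq> points Z" "\<And>x. x \<in> points X \<Longrightarrow> dist x (f x) < \<eta>"
          "weighted_dist \<omega> X (Ran (f ` points X)) < \<eta>"
        using weighted_dist_less_map[OF w A(2)[OF elim(1) Z(1)]] by blast
      \<comment> \<open>\<open>f\<close> follows the chain from \<open>X\<close> into \<open>Z\<close>, and \<open>q\<close> rounds off to \<open>K\<close>.\<close>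
      obtain q where q: "\<And>z. z \<in> points Z \<Longrightarrow> q z \<in> points K \<and> dist z (q z) < \<tau>"
        using Z(2) by metis
      define W where "W = Ran (f ` points X)"
      have W: "points W = f ` points X"
        by (simp add: W_def points_Ran)
      have "p \<in> q ` points W" if p: "p \<in> points K" for p
      proof -
        obtain x where x: "x \<in> points X" "dist p x < \<eta>"
          using elim(2) p by blast
        then have fx: "f x \<in> points Z"
          using f(1) by blast
        have "dist p (q (f x)) < s"
          using x(2) f(2)[OF x(1)] q[OF fx] \<eta>(3) \<tau>(2) dist_triangle[of p "f x" x]
            dist_triangle[of p "q (f x)" "f x"]
          by linarith
        then have "p = q (f x)"
          using s(2)[OF p, of "q (f x)"] q[OF fx] by force
        then show ?thesis
          using W x(1) by blast
      qed
      then have qW: "q ` points W = points K"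
        using W f(1) q by blast
      have cW: "card (points W) \<le> card (points X)"
        unfolding W by (intro card_image_le) simp
      have sum: "(\<Sum>z\<in>points W. dist z (q z)) \<le> real (card (points X)) * \<tau>"
      proof -
        have "(\<Sum>z\<in>points W. dist z (q z)) \<le> real (card (points W)) * \<tau>"
          using W f(1) q by (intro sum_bounded_above less_imp_le) blast
        also have "\<dots> \<le> real (card (points X)) * \<tau>"
          using cW \<tau>(1) by simp
        finally show ?thesis .
      qed
      have "weighted_dist \<omega> W K \<le> \<omega> (card (points W)) * (\<Sum>z\<in>points W. dist z (q z))"
        using weighted_dist_image_le[OF w, of W q] by (simp add: qW points_inverse)
      also have "\<dots> \<le> \<omega> (card (points X)) * (real (card (points X)) * \<tau>)"
        using weight_mono[OF w card_points_ge_1 cW] weight_ge_1[OF w card_points_ge_1[of X]]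
        by (intro mult_mono sum) (auto intro: sum_nonneg)
      finally have "weighted_dist \<omega> W K \<le> c * \<tau>"
        by (simp add: c_def mult.assoc)
      then have "weighted_dist \<omega> X K < \<epsilon>"
        using weighted_dist_triangle[OF w, of X K W] f(3) \<tau>(3) \<eta>(2) unfolding W_def by linarith
      then show ?case
        using weighted_dist_sym_le[OF w, of K X] by linarith
    qed
  qed
  show ?thesis
  proof (rule filter_leI)
    fix P
    assume "eventually P (nhds (Ran (limit_points F)))"
    then obtain \<omega> \<epsilon> where "weight \<omega>" "\<epsilon> > 0" "\<And>X. weighted_dist \<omega> K X < \<epsilon> \<Longrightarrow> P X"
      unfolding eventually_nhds_uniformity eventually_uniformity_ran
      by (auto simp: ran_entourage_def K_def)
    then show "eventually P F"
      using conv[of \<omega> \<epsilon>] by (auto elim: eventually_mono)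
  qed
qed

theorem theorem2:
  assumes "locally_compact_space (euclidean :: 'a::metric_space topology)"
    and "complete (UNIV :: 'a set)"
  shows "complete (UNIV :: 'a ran set)"
  unfolding complete_uniform using cauchy_filter_ran_converges[OF assms(2)] by blast

end
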